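(* Let $\Phi\subseteq V^*$ be an essential irreducible root system of classical type ($\mathrm A_n$, $\mathrm B_n$, $\mathrm C_n$ or $\mathrm D_n$), and let $\mathcal V\subseteq V$ be the vertex set of the Euclidean Coxeter complex $\Sigma$ of type $\Phi$. Let $f:\mathcal V\to\mathbb R\cup\{+\infty\}$ be an L-convex function of type $\Phi$ and $x\in\operatorname{dom} f$. Then $x\in\operatorname{argmin} f$ if and only if $f(x)\le f(y)$ for every proper neighbor $y$ of $x$.
   Context: Root systems. $V$ is a finite-dimensional real inner product space with dual $V^*$, $\langle p,x\rangle=p(x)$ for $p\in V^*,x\in V$; $V^*$ carries the induced inner product. For $\alpha\in V^*\setminus\{0\}$, $\alpha^\vee\in V$ is $2/\|\alpha\|^2$ times the vector of $V$ representing $\alpha$, and $s_\alpha(p)=p-\langle p,\alpha^\vee\rangle\alpha$. A root system is a nonempty finite set $\Phi\subseteq V^*\setminus\{0\}$ with $s_\alpha(\beta)\in\Phi$, $\mathbb R\alpha\cap\Phi=\{\alpha,-\alpha\}$ and $\langle\alpha,\beta^\vee\rangle\in\mathbb Z$ for all $\alpha,\beta\in\Phi$. It is essential if $\operatorname{span}\Phi=V^*$, and irreducible if it is not a disjoint union of two nonempty mutually orthogonal subsets. Euclidean Coxeter complex. For $(\alpha,k)\in\Phi\times\mathbb Z$ let $H^0_{\alpha,k},H^+_{\alpha,k},H^-_{\alpha,k}$ be the sets of $x\in V$ with $\langle\alpha,x\rangle=k$, $>k$, $<k$. An (open) cell is a nonempty set $\bigcap_{(\alpha,k)\in\Phi\times\mathbb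 Z}H^{\sigma_{\alpha,k}}_{\alpha,k}$ with $\sigma_{\alpha,k}\in\{+,0,-\}$. $\Sigma$ is the set of all cells together with $\emptyset$, ordered by $A\preceq B\iff\operatorname{cl}A\subseteq\operatorname{cl}B$; it is a simplicial complex, and each nonempty cell $A$ is the relative interior of a geometric simplex, whose vertex set is denoted $\mathcal V(A)$. $\mathcal V$ is the set of vertices (one-point cells, identified with points of $V$). A proper neighbor of $x\in\mathcal V$ is a vertex $y\in\mathcal V$, $y\ne x$, such that $x,y\in\mathcal V(A)$ for some cell $A$. Convexity notions. A convex set is locally polyhedral if its intersection with every polytope is a polytope; a function is locally polyhedral convex if its epigraph is a locally polyhedral convex set. For a function $h$ on $V$, $\Pi(h)=\{\operatorname{argmin}(h-p): p\in V^*,\ \operatorname{argmin}(h-p)\ne\emptyset\}$, where $(h-p)(x)=h(x)-\langle p,x\rangle$. An integral L-convex polyhedron of type $\Phi$ is a nonempty set $\{x\in V:\langle\alpha,x\rangle\le\gamma(\alpha)\ \forall\alpha\in\Phi\}$ with $\gamma:\Phi\to\mathbb Z\cup\{+\infty\}$. A primal-integral locally polyhedral L-convex function of type $\Phi$ is a proper locally polyhedral convex function $\hat f:V\to\mathbb R\cup\{+\infty\}$ such that every member of $\Pi(\hat f)$ is an integral L-convex polyhedron of type $\Phi$. A function $f:\mathcal V\to\mathbb R\cup\{+\infty\}$ is L-convex of type $\Phi$ if it is the restriction to $\mathcal V$ of some such $\hat f$. $\operatorname{dom} f$ is the set where $f$ is finite. *)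

theory Defs
  imports "HOL-Analysis.Analysis"
begin

text \<open>
  The space \<open>V\<close> is a Euclidean space type. Its dual, with the induced inner product, is
  identified with \<open>V\<close> itself along the Riesz isometry: the functional \<open>p\<close> is represented by
  the vector \<open>p\<close> with \<open>\<langle>p, x\<rangle> = p \<bullet> x\<close>. In particular \<open>\<langle>\<alpha>, \<beta>\<^sup>\<or>\<rangle>\<close> is \<open>\<alpha> \<bullet> coroot \<beta>\<close>.
\<close>

definition coroot :: "'a::euclidean_space \<Rightarrow> 'a" where
  "coroot \<alpha> = (2 / (norm \<alpha>)\<^sup>2) *\<^sub>R \<alpha>"

definition root_reflection :: "'a::euclidean_space \<Rightarrow> 'a \<Rightarrow> 'a" where
  "root_reflection \<alpha> p = p - (p \<bullet> coroot \<alpha>) *\<^sub>R \<alpha>"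

definition root_system :: "'a::euclidean_space set \<Rightarrow> bool" where
  "root_system \<Phi> \<longleftrightarrow>
     \<Phi> \<noteq> {} \<and> finite \<Phi> \<and> 0 \<notin> \<Phi> \<and>
     (\<forall>\<alpha>\<in>\<Phi>. \<forall>\<beta>\<in>\<Phi>. root_reflection \<alpha> \<beta> \<in> \<Phi>) \<and>
     (\<forall>\<alpha>\<in>\<Phi>. span {\<alpha>} \<inter> \<Phi> = {\<alpha>, - \<alpha>}) \<and>
     (\<forall>\<alpha>\<in>\<Phi>. \<forall>\<beta>\<in>\<Phi>. \<alpha> \<bullet> coroot \<beta> \<in> \<int>)"

definition essential :: "'a::euclidean_space set \<Rightarrow> bool" where
  "essential \<Phi> \<longleftrightarrow> span \<Phi> = UNIV"

definition irreducible_roots :: "'a::euclidean_space set \<Rightarrow> bool" where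
  "irreducible_roots \<Phi> \<longleftrightarrow>
     \<not> (\<exists>A B. A \<noteq> {} \<and> B \<noteq> {} \<and> A \<inter> B = {} \<and> A \<union> B = \<Phi> \<and>
           (\<forall>\<alpha>\<in>A. \<forall>\<beta>\<in>B. orthogonal \<alpha> \<beta>))"

text \<open>
  An isomorphism of root systems is a linear isomorphism of the spanned spaces that maps the
  roots onto the roots and preserves the numbers \<open>\<langle>\<alpha>, \<beta>\<^sup>\<or>\<rangle>\<close>; it need not be an isometry.
\<close>

definition root_isomorphic :: "'a::euclidean_space set \<Rightarrow> 'b::euclidean_space set \<Rightarrow> bool" where
  "root_isomorphic \<Phi> \<Psi> \<longleftrightarrow>
     (\<exists>T. linear T \<and> inj_on T (span \<Phi>) \<and> T ` \<Phi> = \<Psi> \<and>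
          (\<forall>\<alpha>\<in>\<Phi>. \<forall>\<beta>\<in>\<Phi>. T \<alpha> \<bullet> coroot (T \<beta>) = \<alpha> \<bullet> coroot \<beta>))"

text \<open>
  The standard classical root systems in coordinates. With \<open>N = CARD('n)\<close> their types are
  \<open>A\<^sub>m\<close> for \<open>m = N - 1\<close> (spanning the hyperplane of coordinate sum 0), and \<open>B\<^sub>N\<close>, \<open>C\<^sub>N\<close>, \<open>D\<^sub>N\<close>.
  No lower bound on the rank is imposed: a set isomorphic to a small-rank member is either
  empty, reducible, or again of one of the usual classical types
  (\<open>B\<^sub>1 \<cong> C\<^sub>1 \<cong> A\<^sub>1\<close>, \<open>C\<^sub>2 \<cong> B\<^sub>2\<close>, \<open>D\<^sub>3 \<cong> A\<^sub>3\<close>).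
\<close>

definition roots_A :: "(real ^ 'n) set" where
  "roots_A = {axis i 1 - axis j 1 | i j. i \<noteq> j}"

definition roots_D :: "(real ^ 'n) set" where
  "roots_D = {s *\<^sub>R axis i 1 + t *\<^sub>R axis j 1 | i j s t.
     i \<noteq> j \<and> s \<in> {1, - 1} \<and> t \<in> {1, - 1}}"

definition roots_B :: "(real ^ 'n) set" where
  "roots_B = roots_D \<union> {s *\<^sub>R axis i 1 | i s. s \<in> {1, - 1}}"

definition roots_C :: "(real ^ 'n) set" where
  "roots_C = roots_D \<union> {(2 * s) *\<^sub>R axis i 1 | i s. s \<in> {1, - 1}}"


datatype cell_sign = Plus | Zero | Minus

fun hyp :: "'a::euclidean_space \<Rightarrow> int \<Rightarrow> cell_sign \<Rightarrow> 'a set" where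
  "hyp \<alpha> k Plus = {x. \<alpha> \<bullet> x > of_int k}"
| "hyp \<alpha> k Zero = {x. \<alpha> \<bullet> x = of_int k}"
| "hyp \<alpha> k Minus = {x. \<alpha> \<bullet> x < of_int k}"

definition coxeter_cell :: "'a::euclidean_space set \<Rightarrow> 'a set \<Rightarrow> bool" where
  "coxeter_cell \<Phi> A \<longleftrightarrow>
     A \<noteq> {} \<and> (\<exists>\<sigma>. A = (\<Inter>(\<alpha>, k) \<in> \<Phi> \<times> (UNIV :: int set). hyp \<alpha> k (\<sigma> (\<alpha>, k))))"

text \<open>
  A cell \<open>A\<close> is the relative interior of a geometric simplex, which is then the closure of \<open>A\<close>;
  the vertices of that simplex are its extreme points.
\<close>

definition cell_vertices :: "'a::euclidean_space set \<Rightarrow> 'a set" where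
  "cell_vertices A = {v. v extreme_point_of closure A}"

lemma cell_vertices_simplex:
  fixes C :: "'a::euclidean_space set"
  assumes "\<not> affine_dependent C" and "A = rel_interior (convex hull C)"
  shows "cell_vertices A = C"
proof -
  have "closed (convex hull C)"
    using assms(1) by (simp add: aff_independent_finite compact_convex_hull compact_imp_closed finite_imp_compact)
  then have "closure A = convex hull C"
    using assms(2) by (simp add: convex_closure_rel_interior closure_closed)
  then show ?thesis
    using assms(1) by (simp add: cell_vertices_def extreme_point_of_convex_hull_affine_independent)
qed

definition coxeter_vertices :: "'a::euclidean_space set \<Rightarrow> 'a set" where
  "coxeter_vertices \<Phi> = {x. coxeter_cell \<Phi> {x}}"

definition proper_neighbor :: "'a::euclidean_space set \<Rightarrow> 'a \<Rightarrow> 'a \<Rightarrow> bool" where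
  "proper_neighbor \<Phi> x y \<longleftrightarrow>
     y \<in> coxeter_vertices \<Phi> \<and> y \<noteq> x \<and>
     (\<exists>A. coxeter_cell \<Phi> A \<and> x \<in> cell_vertices A \<and> y \<in> cell_vertices A)"


definition locally_polyhedral :: "'a::euclidean_space set \<Rightarrow> bool" where
  "locally_polyhedral S \<longleftrightarrow> convex S \<and> (\<forall>P. polytope P \<longrightarrow> polytope (S \<inter> P))"

definition ereal_epigraph :: "('a::euclidean_space \<Rightarrow> ereal) \<Rightarrow> ('a \<times> real) set" where
  "ereal_epigraph h = {(x, r). h x \<le> ereal r}"

definition locally_polyhedral_convex :: "('a::euclidean_space \<Rightarrow> ereal) \<Rightarrow> bool" where
  "locally_polyhedral_convex h \<longleftrightarrow> locally_polyhedral (ereal_epigraph h)"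

definition proper_fun :: "('a \<Rightarrow> ereal) \<Rightarrow> bool" where
  "proper_fun h \<longleftrightarrow> (\<forall>x. h x \<noteq> - \<infinity>) \<and> (\<exists>x. h x \<noteq> \<infinity>)"

definition argmin_on :: "'a set \<Rightarrow> ('a \<Rightarrow> ereal) \<Rightarrow> 'a set" where
  "argmin_on S h = {x. is_arg_min h (\<lambda>x. x \<in> S) x}"

definition linearity_domains :: "('a::euclidean_space \<Rightarrow> ereal) \<Rightarrow> 'a set set" where
  "linearity_domains h =
     {argmin_on UNIV (\<lambda>x. h x - ereal (p \<bullet> x)) | p.
        argmin_on UNIV (\<lambda>x. h x - ereal (p \<bullet> x)) \<noteq> {}}"

definition integral_L_convex_polyhedron ::
    "'a::euclidean_space set \<Rightarrow> 'a set \<Rightarrow> bool" where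
  "integral_L_convex_polyhedron \<Phi> P \<longleftrightarrow>
     P \<noteq> {} \<and>
     (\<exists>\<gamma> :: 'a \<Rightarrow> ereal.
        (\<forall>\<alpha>\<in>\<Phi>. \<gamma> \<alpha> \<in> insert \<infinity> (range (\<lambda>k::int. ereal (of_int k)))) \<and>
        P = {x. \<forall>\<alpha>\<in>\<Phi>. ereal (\<alpha> \<bullet> x) \<le> \<gamma> \<alpha>})"

definition primal_integral_L_convex ::
    "'a::euclidean_space set \<Rightarrow> ('a \<Rightarrow> ereal) \<Rightarrow> bool" where
  "primal_integral_L_convex \<Phi> h \<longleftrightarrow>
     proper_fun h \<and> locally_polyhedral_convex h \<and>
     (\<forall>P \<in> linearity_domains h. integral_L_convex_polyhedron \<Phi> P)"

text \<open>
  A function on the vertex set is given by a function on the whole space whose values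
  outside the vertex set are irrelevant.
\<close>

definition L_convex :: "'a::euclidean_space set \<Rightarrow> ('a \<Rightarrow> ereal) \<Rightarrow> bool" where
  "L_convex \<Phi> f \<longleftrightarrow>
     (\<exists>h. primal_integral_L_convex \<Phi> h \<and> (\<forall>v \<in> coxeter_vertices \<Phi>. f v = h v))"

end

theory Submission
  imports Defs
begin

text \<open>
  A minimizer is trivially minimal among its neighbors. For the converse, let \<open>h\<close> be a convex
  extension of \<open>f\<close> and suppose that \<open>h z < h x\<close> for some \<open>z\<close>; a proper neighbor \<open>y\<close> of \<open>x\<close>
  with \<open>h y < h x\<close> is found as follows.

  Near \<open>(x, h x)\<close> the epigraph of \<open>h\<close> is a polyhedron. Among its linear inequalities that are
  tight at this point there is one that determines the directional derivative of \<open>h\<close> at \<open>x\<close>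
  along \<open>u = z - x\<close>, and its normal gives a subgradient \<open>p\<close> of \<open>h\<close> at \<open>x\<close> with \<open>p \<bullet> u \<le> h z - h x < 0\<close> and
  \<open>h (x + s u) = h x + s (p \<bullet> u)\<close> for all small \<open>s > 0\<close> (\<open>locally_polyhedral_subgradient\<close>).
  Hence the linearity domain \<open>P = argmin (h - p)\<close> contains both \<open>x\<close> and \<open>m = x + s u\<close>.

  As \<open>P\<close> is cut out by inequalities \<open>\<alpha> \<bullet> w \<le> k\<close> with integers \<open>k\<close>, it contains the closure of
  the cell of \<open>m\<close> (\<open>integral_L_convex_polyhedron_closure_cell\<close>), which contains \<open>x\<close> if \<open>s\<close>
  is small (\<open>eventually_in_closure_cell_of\<close>). The vertices of a cell are exactly the
  one-point cells in its closure (\<open>cell_vertices_cell_of\<close>), so \<open>x\<close> is a vertex of the cell of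
  \<open>m\<close> and its other vertices are proper neighbors of \<open>x\<close>. The roots span the space, so the
  cell is bounded and its closure is the convex hull of its vertices; since
  \<open>p \<bullet> m < p \<bullet> x\<close>, some vertex \<open>y\<close> has \<open>p \<bullet> y < p \<bullet> x\<close> (\<open>cell_vertex_decreasing\<close>).
  Finally \<open>y \<in> P\<close>, where \<open>h\<close> is affine with slope \<open>p\<close>, so \<open>h y < h x\<close>.
\<close>

section \<open>Supporting hyperplanes of locally polyhedral epigraphs\<close>

lemma polyhedron_inequalities:
  fixes P :: "'a::euclidean_space set"
  assumes "polyhedron P"
  obtains F where "finite F" and "P = {y. \<forall>(a, b) \<in> F. a \<bullet> y \<le> b}"
proof -
  obtain G where G: "finite G" "P = \<Inter>G" "\<forall>H\<in>G. \<exists>a b. a \<noteq> 0 \<and> H = {y. a \<bullet> y \<le> b}"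
    using assms unfolding polyhedron_def by blast
  then obtain a b where ab: "\<And>H. H \<in> G \<Longrightarrow> H = {y. a H \<bullet> y \<le> b H}"
    by metis
  have "P = {y. \<forall>H\<in>G. a H \<bullet> y \<le> b H}"
    using ab G(2) by blast
  then show ?thesis
    using that[of "(\<lambda>H. (a H, b H)) ` G"] G(1) by auto
qed

lemma eventually_at_right_0_linear_less:
  fixes c d :: real
  assumes "c > 0"
  shows "\<forall>\<^sub>F s in at_right 0. s * d < c"
proof -
  have "((\<lambda>s::real. s * d) \<longlongrightarrow> 0 * d) (at_right 0)"
    by (intro tendsto_intros)
  then show ?thesis
    using assms by (simp add: order_tendsto_iff)
qed

text \<open>
  The directions that stay in a polyhedron for a short while are those that satisfy the
  homogeneous versions of the inequalities that are tight at the base point.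
\<close>

lemma feasible_direction_iff:
  fixes e v :: "'a::euclidean_space"
  assumes "finite F" and e: "\<forall>(a, b) \<in> F. a \<bullet> e \<le> b"
  shows "(\<forall>\<^sub>F s in at_right 0. \<forall>(a, b) \<in> F. a \<bullet> (e + s *\<^sub>R v) \<le> b)
     \<longleftrightarrow> (\<forall>(a, b) \<in> F. a \<bullet> e = b \<longrightarrow> a \<bullet> v \<le> 0)"
proof
  assume ev: "\<forall>\<^sub>F s in at_right 0. \<forall>(a, b) \<in> F. a \<bullet> (e + s *\<^sub>R v) \<le> b"
  have "\<forall>\<^sub>F s::real in at_right 0. s > 0"
    by (rule eventually_at_right_less)
  with ev have "\<forall>\<^sub>F s in at_right 0. s > 0 \<and> (\<forall>(a, b) \<in> F. a \<bullet> (e + s *\<^sub>R v) \<le> b)"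
    by eventually_elim auto
  then obtain s where s: "s > 0" "\<forall>(a, b) \<in> F. a \<bullet> (e + s *\<^sub>R v) \<le> b"
    using eventually_happens trivial_limit_at_right_real by blast
  show "\<forall>(a, b) \<in> F. a \<bullet> e = b \<longrightarrow> a \<bullet> v \<le> 0"
  proof clarify
    fix a assume "(a, a \<bullet> e) \<in> F"
    then have "a \<bullet> (e + s *\<^sub>R v) \<le> a \<bullet> e"
      using s(2) by blast
    then show "a \<bullet> v \<le> 0"
      using s(1) by (simp add: inner_add_right mult_le_0_iff)
  qed
next
  assume act: "\<forall>(a, b) \<in> F. a \<bullet> e = b \<longrightarrow> a \<bullet> v \<le> 0"
  have "\<forall>\<^sub>F s in at_right 0. (fst q) \<bullet> (e + s *\<^sub>R v) \<le> snd q" if "q \<in> F" for q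
  proof (cases "fst q \<bullet> e = snd q")
    case True
    have "\<forall>\<^sub>F s::real in at_right 0. s > 0"
      by (rule eventually_at_right_less)
    then show ?thesis
      by eventually_elim
        (use True act that in \<open>auto simp: inner_add_right case_prod_beta mult_le_0_iff\<close>)
  next
    case False
    then have "snd q - fst q \<bullet> e > 0"
      using e that by (force simp: case_prod_beta)
    from eventually_at_right_0_linear_less[OF this, of "fst q \<bullet> v"] show ?thesis
      by eventually_elim (simp add: inner_add_right)
  qed
  then show "\<forall>\<^sub>F s in at_right 0. \<forall>(a, b) \<in> F. a \<bullet> (e + s *\<^sub>R v) \<le> b"
    using assms(1) by (simp add: eventually_ball_finite case_prod_beta)
qed

text \<open>
  The set \<open>E\<close> plays the role of the epigraph of a convex function with value \<open>c\<close> at \<open>x\<close> and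
  value at most \<open>c + d\<close> at \<open>x + u\<close>; the vector \<open>p\<close> is a subgradient at \<open>x\<close> that attains the
  directional derivative along \<open>u\<close>.
\<close>

lemma locally_polyhedral_subgradient:
  fixes E :: "('a::euclidean_space \<times> real) set"
  assumes lp: "locally_polyhedral E" and e: "(x, c) \<in> E"
    and up: "\<And>r. c \<le> r \<Longrightarrow> (x, r) \<in> E" and low: "\<And>r. (x, r) \<in> E \<Longrightarrow> c \<le> r"
    and u: "(x + u, c + d) \<in> E"
  obtains p where "\<And>y r. (y, r) \<in> E \<Longrightarrow> c + p \<bullet> (y - x) \<le> r"
    and "p \<bullet> u \<le> d"
    and "\<forall>\<^sub>F s in at_right 0. (x + s *\<^sub>R u, c + s * (p \<bullet> u)) \<in> E"
proof -
  define Q where "Q = cbox ((x, c) - One) ((x, c) + One)"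
  have conv: "convex E"
    using lp by (simp add: locally_polyhedral_def)
  have "polytope (E \<inter> Q)"
    using lp by (simp add: locally_polyhedral_def Q_def polytope_interval)
  then have "polyhedron (E \<inter> Q)"
    by (rule polytope_imp_polyhedron)
  then obtain F where F: "finite F" "E \<inter> Q = {y. \<forall>(a, b) \<in> F. a \<bullet> y \<le> b}"
    by (rule polyhedron_inequalities)
  have "q \<in> box (q - One) (q + One)" for q :: "'a \<times> real"
    by (simp add: mem_box inner_diff_left inner_add_left)
  then have int: "(x, c) \<in> interior Q"
    by (simp add: Q_def interior_cbox)
  then have eQ: "\<forall>(a, b) \<in> F. a \<bullet> (x, c) \<le> b"
    using F(2) e interior_subset by blast
  have nearQ: "\<forall>\<^sub>F s in at_right 0. (x, c) + s *\<^sub>R v \<in> Q" for v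
  proof -
    have "((\<lambda>s::real. (x, c) + s *\<^sub>R v) \<longlongrightarrow> (x, c) + 0 *\<^sub>R v) (at_right 0)"
      by (intro tendsto_intros)
    then have "\<forall>\<^sub>F s in at_right 0. (x, c) + s *\<^sub>R v \<in> interior Q"
      by (rule topological_tendstoD) (use int in auto)
    then show ?thesis
      by eventually_elim (use interior_subset in blast)
  qed
  have dir: "(\<forall>\<^sub>F s in at_right 0. (x, c) + s *\<^sub>R v \<in> E)
      \<longleftrightarrow> (\<forall>(a, b) \<in> F. a \<bullet> (x, c) = b \<longrightarrow> a \<bullet> v \<le> 0)" for v
  proof -
    have "(\<forall>\<^sub>F s in at_right 0. (x, c) + s *\<^sub>R v \<in> E)
        \<longleftrightarrow> (\<forall>\<^sub>F s in at_right 0. (x, c) + s *\<^sub>R v \<in> E \<inter> Q)"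
      using nearQ[of v] by (auto elim: eventually_elim2 simp: eventually_conj_iff)
    then show ?thesis
      using feasible_direction_iff[OF F(1) eQ, of v] F(2) by simp
  qed
  \<comment> \<open>By convexity, moving from \<open>(x, c)\<close> towards any point of \<open>E\<close> is feasible.\<close>
  have dirE: "\<forall>(a, b) \<in> F. a \<bullet> (x, c) = b \<longrightarrow> a \<bullet> (q - (x, c)) \<le> 0" if "q \<in> E" for q
  proof -
    have "\<forall>\<^sub>F s::real in at_right 0. s \<in> {0<..<1}"
      by (rule eventually_at_right_real) simp
    then have "\<forall>\<^sub>F s in at_right 0. (x, c) + s *\<^sub>R (q - (x, c)) \<in> E"
    proof eventually_elim
      case (elim s)
      have "(x, c) + s *\<^sub>R (q - (x, c)) = (1 - s) *\<^sub>R (x, c) + s *\<^sub>R q"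
        by (simp add: algebra_simps)
      then show ?case
        using elim convexD_alt[OF conv e that, of s] by simp
    qed
    then show ?thesis
      using dir by blast
  qed
  \<comment> \<open>The normals of the constraints that are active at \<open>(x, c)\<close>.\<close>
  define I where "I = {a. (a, a \<bullet> (x, c)) \<in> F}"
  have finI: "finite I"
    by (rule finite_subset[of _ "fst ` F"]) (use F(1) in \<open>force simp: I_def\<close>)+
  have dir': "(\<forall>\<^sub>F s in at_right 0. (x, c) + s *\<^sub>R v \<in> E) \<longleftrightarrow> (\<forall>a\<in>I. a \<bullet> v \<le> 0)" for v
    unfolding dir I_def by auto
  have dirE': "a \<bullet> (q - (x, c)) \<le> 0" if "q \<in> E" "a \<in> I" for q a
    using dirE[OF that(1)] that(2) by (auto simp: I_def)
  \<comment> \<open>The direction pointing straight up is feasible.\<close>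
  have nonpos: "snd a \<le> 0" if "a \<in> I" for a
    using dirE'[OF up[of "c + 1"] that] by (simp add: inner_prod_def)
  define J where "J = {a\<in>I. snd a < 0}"
  \<comment> \<open>Were \<open>J\<close> empty, the direction pointing straight down would be feasible.\<close>
  have "J \<noteq> {}"
  proof
    assume "J = {}"
    then have "\<forall>a\<in>I. a \<bullet> (0, - 1) \<le> 0"
      using nonpos by (fastforce simp: J_def inner_prod_def)
    then have "\<forall>\<^sub>F s in at_right 0. (x, c) + s *\<^sub>R (0, - 1) \<in> E"
      using dir' by blast
    moreover have "\<forall>\<^sub>F s::real in at_right 0. s > 0"
      by (rule eventually_at_right_less)
    ultimately have "\<forall>\<^sub>F s::real in at_right 0. False"
      by eventually_elim (use low in force)
    then show False
      by simp
  qed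
  moreover have "finite J"
    using finI by (simp add: J_def)
  moreover define g where "g a = (fst a \<bullet> u) / (- snd a)" for a :: "'a \<times> real"
  \<comment> \<open>The active constraint that is steepest along \<open>u\<close> gives the directional derivative.\<close>
  ultimately have "Max (g ` J) \<in> g ` J"
    by (intro Max_in) simp_all
  then obtain a where a: "a \<in> J" and "g a = Max (g ` J)"
    by auto
  then have amax: "g a' \<le> g a" if "a' \<in> J" for a'
    using \<open>finite J\<close> that by simp
  define p where "p = (1 / - snd a) *\<^sub>R fst a"
  have neg: "snd a < 0" and aI: "a \<in> I"
    using a by (auto simp: J_def)
  have fsta: "fst a = (- snd a) *\<^sub>R p"
    using neg by (simp add: p_def)
  have sub: "c + p \<bullet> (y - x) \<le> r" if "(y, r) \<in> E" for y r
  proof -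
    have "(- snd a) * (p \<bullet> (y - x) - (r - c)) \<le> 0"
      using dirE'[OF that aI] fsta by (simp add: inner_prod_def algebra_simps)
    then have "p \<bullet> (y - x) - (r - c) \<le> 0"
      using neg by (simp only: mult_le_0_iff) linarith
    then show ?thesis
      by simp
  qed
  have "p \<bullet> u \<le> d"
    using sub[OF u] by simp
  have "a' \<bullet> (u, p \<bullet> u) \<le> 0" if "a' \<in> I" for a'
  proof (cases "snd a' < 0")
    case True
    then have "(fst a' \<bullet> u) / (- snd a') \<le> p \<bullet> u"
      using amax[of a'] that by (simp add: J_def p_def g_def)
    then show ?thesis
      using True by (simp add: inner_prod_def field_simps)
  next
    case False
    then have "snd a' = 0"
      using nonpos[OF that] by simp
    then show ?thesis
      using dirE'[OF u that] by (simp add: inner_prod_def)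
  qed
  then have "\<forall>\<^sub>F s in at_right 0. (x, c) + s *\<^sub>R (u, p \<bullet> u) \<in> E"
    using dir' by blast
  then show ?thesis
    using that[OF sub \<open>p \<bullet> u \<le> d\<close>] by simp
qed

section \<open>Cells and their vertices\<close>

text \<open>
  The cell containing the point \<open>m\<close>. For real numbers \<open>a\<close> and \<open>b\<close>, all the signs of \<open>a - k\<close> and
  \<open>b - k\<close> with \<open>k\<close> an integer agree iff \<open>a\<close> and \<open>b\<close> have the same floor and the same ceiling.
\<close>

definition cell_of :: "'a::euclidean_space set \<Rightarrow> 'a \<Rightarrow> 'a set" where
  "cell_of \<Phi> m =
     {w. \<forall>\<alpha>\<in>\<Phi>. \<lfloor>\<alpha> \<bullet> w\<rfloor> = \<lfloor>\<alpha> \<bullet> m\<rfloor> \<and> \<lceil>\<alpha> \<bullet> w\<rceil> = \<lceil>\<alpha> \<bullet> m\<rceil>}"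

lemma self_in_cell_of: "m \<in> cell_of \<Phi> m"
  by (simp add: cell_of_def)

lemma hyp_cong:
  assumes "\<lfloor>\<alpha> \<bullet> w\<rfloor> = \<lfloor>\<alpha> \<bullet> m\<rfloor>" and "\<lceil>\<alpha> \<bullet> w\<rceil> = \<lceil>\<alpha> \<bullet> m\<rceil>"
  shows "w \<in> hyp \<alpha> k s \<longleftrightarrow> m \<in> hyp \<alpha> k s"
proof -
  have "of_int k \<le> \<alpha> \<bullet> w \<longleftrightarrow> of_int k \<le> \<alpha> \<bullet> m" "\<alpha> \<bullet> w \<le> of_int k \<longleftrightarrow> \<alpha> \<bullet> m \<le> of_int k"
    using assms by (metis le_floor_iff, metis ceiling_le_iff)
  then show ?thesis
    by (cases s) auto
qed

lemma hyp_same_side: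
  assumes "w \<in> hyp \<alpha> k s" and "m \<in> hyp \<alpha> k s"
  shows "of_int k \<le> \<alpha> \<bullet> w \<longleftrightarrow> of_int k \<le> \<alpha> \<bullet> m" and "\<alpha> \<bullet> w \<le> of_int k \<longleftrightarrow> \<alpha> \<bullet> m \<le> of_int k"
  using assms by (cases s; auto)+

lemma hyp_Inter_eq_cell_of:
  fixes \<Phi> :: "'a::euclidean_space set"
  assumes "m \<in> (\<Inter>(\<alpha>, k) \<in> \<Phi> \<times> (UNIV :: int set). hyp \<alpha> k (\<sigma> (\<alpha>, k)))"
  shows "(\<Inter>(\<alpha>, k) \<in> \<Phi> \<times> (UNIV :: int set). hyp \<alpha> k (\<sigma> (\<alpha>, k))) = cell_of \<Phi> m"
    (is "?A = _")
proof
  have m: "m \<in> hyp \<alpha> k (\<sigma> (\<alpha>, k))" if "\<alpha> \<in> \<Phi>" for \<alpha> k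
    using assms that by auto
  show "cell_of \<Phi> m \<subseteq> ?A"
    using m hyp_cong by (fastforce simp: cell_of_def)
  show "?A \<subseteq> cell_of \<Phi> m"
  proof
    fix w assume w: "w \<in> ?A"
    have "\<lfloor>\<alpha> \<bullet> w\<rfloor> = \<lfloor>\<alpha> \<bullet> m\<rfloor> \<and> \<lceil>\<alpha> \<bullet> w\<rceil> = \<lceil>\<alpha> \<bullet> m\<rceil>" if "\<alpha> \<in> \<Phi>" for \<alpha>
    proof -
      have "w \<in> hyp \<alpha> k (\<sigma> (\<alpha>, k))" for k
        using w that by auto
      then have "k \<le> \<lfloor>\<alpha> \<bullet> w\<rfloor> \<longleftrightarrow> k \<le> \<lfloor>\<alpha> \<bullet> m\<rfloor>" "\<lceil>\<alpha> \<bullet> w\<rceil> \<le> k \<longleftrightarrow> \<lceil>\<alpha> \<bullet> m\<rceil> \<le> k" for k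
        using hyp_same_side m[OF that] by (metis le_floor_iff, metis ceiling_le_iff)
      then show ?thesis
        by (meson order_antisym order_refl)
    qed
    then show "w \<in> cell_of \<Phi> m"
      by (simp add: cell_of_def)
  qed
qed

lemma coxeter_cell_iff: "coxeter_cell \<Phi> A \<longleftrightarrow> (\<exists>m. A = cell_of \<Phi> m)"
proof
  assume "coxeter_cell \<Phi> A"
  then obtain m \<sigma> where A: "A = (\<Inter>(\<alpha>, k) \<in> \<Phi> \<times> UNIV. hyp \<alpha> k (\<sigma> (\<alpha>, k)))" and "m \<in> A"
    unfolding coxeter_cell_def by blast
  then have "A = cell_of \<Phi> m"
    using hyp_Inter_eq_cell_of[of m \<sigma> \<Phi>] by simp
  then show "\<exists>m. A = cell_of \<Phi> m" ..
next
  assume "\<exists>m. A = cell_of \<Phi> m"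
  then obtain m where A: "A = cell_of \<Phi> m" ..
  define \<sigma> where "\<sigma> = (\<lambda>(\<alpha>, k :: int).
    if of_int k < \<alpha> \<bullet> m then Plus else if \<alpha> \<bullet> m = of_int k then Zero else Minus)"
  have "m \<in> (\<Inter>(\<alpha>, k) \<in> \<Phi> \<times> UNIV. hyp \<alpha> k (\<sigma> (\<alpha>, k)))"
    by (auto simp: \<sigma>_def)
  then have "A = (\<Inter>(\<alpha>, k) \<in> \<Phi> \<times> UNIV. hyp \<alpha> k (\<sigma> (\<alpha>, k)))"
    using A hyp_Inter_eq_cell_of[of m \<sigma> \<Phi>] by blast
  moreover have "A \<noteq> {}"
    using A self_in_cell_of by blast
  ultimately show "coxeter_cell \<Phi> A"
    unfolding coxeter_cell_def by blast
qed

lemma not_Ints_floor_ceiling: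
  fixes b :: real
  assumes "b \<notin> \<int>"
  shows "of_int \<lfloor>b\<rfloor> < b" and "\<lceil>b\<rceil> = \<lfloor>b\<rfloor> + 1" and "b < of_int \<lceil>b\<rceil>"
proof -
  have "of_int \<lfloor>b\<rfloor> \<noteq> b" "of_int \<lceil>b\<rceil> \<noteq> b"
    using assms by (metis Ints_of_int)+
  then show "of_int \<lfloor>b\<rfloor> < b" and "\<lceil>b\<rceil> = \<lfloor>b\<rfloor> + 1" and "b < of_int \<lceil>b\<rceil>"
    by linarith+
qed

text \<open>
  Every point of the right-hand side is a limit of cell points on its segment to \<open>m\<close>.
\<close>

lemma closure_cell_of:
  fixes \<Phi> :: "'a::euclidean_space set"
  shows "closure (cell_of \<Phi> m) =
    {w. \<forall>\<alpha>\<in>\<Phi>. of_int \<lfloor>\<alpha> \<bullet> m\<rfloor> \<le> \<alpha> \<bullet> w \<and> \<alpha> \<bullet> w \<le> of_int \<lceil>\<alpha> \<bullet> m\<rceil>}" (is "_ = ?W")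
proof
  have W: "?W = (\<Inter>\<alpha>\<in>\<Phi>. {w. \<alpha> \<bullet> w \<ge> of_int \<lfloor>\<alpha> \<bullet> m\<rfloor>} \<inter> {w. \<alpha> \<bullet> w \<le> of_int \<lceil>\<alpha> \<bullet> m\<rceil>})"
    by auto
  have "closed ?W"
    unfolding W by (intro closed_INT ballI closed_Int closed_halfspace_le closed_halfspace_ge)
  moreover have "cell_of \<Phi> m \<subseteq> ?W"
  proof
    fix w assume w: "w \<in> cell_of \<Phi> m"
    have "of_int \<lfloor>\<alpha> \<bullet> m\<rfloor> \<le> \<alpha> \<bullet> w \<and> \<alpha> \<bullet> w \<le> of_int \<lceil>\<alpha> \<bullet> m\<rceil>" if "\<alpha> \<in> \<Phi>" for \<alpha>
    proof -
      have "\<lfloor>\<alpha> \<bullet> w\<rfloor> = \<lfloor>\<alpha> \<bullet> m\<rfloor>" "\<lceil>\<alpha> \<bullet> w\<rceil> = \<lceil>\<alpha> \<bullet> m\<rceil>"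
        using w that by (auto simp: cell_of_def)
      then show ?thesis
        by linarith
    qed
    then show "w \<in> ?W"
      by simp
  qed
  ultimately show "closure (cell_of \<Phi> m) \<subseteq> ?W"
    by (rule closure_minimal[rotated])
  show "?W \<subseteq> closure (cell_of \<Phi> m)"
  proof
    fix w assume w: "w \<in> ?W"
    have "(1 - t) *\<^sub>R w + t *\<^sub>R m \<in> cell_of \<Phi> m" if t: "0 < t" "t < 1" for t
    proof -
      have "\<lfloor>\<alpha> \<bullet> ((1 - t) *\<^sub>R w + t *\<^sub>R m)\<rfloor> = \<lfloor>\<alpha> \<bullet> m\<rfloor> \<and>
            \<lceil>\<alpha> \<bullet> ((1 - t) *\<^sub>R w + t *\<^sub>R m)\<rceil> = \<lceil>\<alpha> \<bullet> m\<rceil>" if "\<alpha> \<in> \<Phi>" for \<alpha>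
      proof -
        define a b where "a = \<alpha> \<bullet> w" and "b = \<alpha> \<bullet> m"
        have ab: "of_int \<lfloor>b\<rfloor> \<le> a" "a \<le> of_int \<lceil>b\<rceil>"
          using w that by (auto simp: a_def b_def)
        have eq: "\<alpha> \<bullet> ((1 - t) *\<^sub>R w + t *\<^sub>R m) = a + t * (b - a)"
          by (simp add: a_def b_def inner_add_right algebra_simps)
        have "\<lfloor>a + t * (b - a)\<rfloor> = \<lfloor>b\<rfloor> \<and> \<lceil>a + t * (b - a)\<rceil> = \<lceil>b\<rceil>"
        \<comment> \<open>If \<open>b\<close> is an integer, then \<open>a = b\<close>.\<close>
        proof (cases "b \<in> \<int>")
          case True
          then obtain k where "b = of_int k"
            by (auto elim: Ints_cases)
          then show ?thesis
            using ab by simp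
        next
          case False
          note k = not_Ints_floor_ceiling[OF this]
          have "(1 - t) * of_int \<lfloor>b\<rfloor> + t * of_int \<lfloor>b\<rfloor> < (1 - t) * a + t * b"
            using k t ab by (intro add_le_less_mono mult_left_mono mult_strict_left_mono) auto
          moreover have "(1 - t) * a + t * b < (1 - t) * of_int \<lceil>b\<rceil> + t * of_int \<lceil>b\<rceil>"
            using k t ab by (intro add_le_less_mono mult_left_mono mult_strict_left_mono) auto
          ultimately have "of_int \<lfloor>b\<rfloor> < a + t * (b - a)" "a + t * (b - a) < of_int \<lceil>b\<rceil>"
            by (simp_all add: algebra_simps)
          then show ?thesis
            using k(2) by (auto intro!: floor_unique ceiling_unique)
        qed
        then show ?thesis
          by (simp add: eq b_def)
      qed
      then show ?thesis
        by (simp add: cell_of_def)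
    qed
    moreover have "\<forall>\<^sub>F t::real in at_right 0. t \<in> {0<..<1}"
      by (rule eventually_at_right_real) simp
    ultimately have "\<forall>\<^sub>F t in at_right 0. (1 - t) *\<^sub>R w + t *\<^sub>R m \<in> closure (cell_of \<Phi> m)"
      using closure_subset by (auto elim!: eventually_mono)
    moreover have "((\<lambda>t. (1 - t) *\<^sub>R w + t *\<^sub>R m) \<longlongrightarrow> (1 - 0) *\<^sub>R w + 0 *\<^sub>R m) (at_right 0)"
      by (intro tendsto_intros)
    ultimately show "w \<in> closure (cell_of \<Phi> m)"
      using Lim_in_closed_set[of "closure (cell_of \<Phi> m)" _ "at_right (0::real)"] by simp
  qed
qed

text \<open>Every linear functional is a combination of roots, hence bounded on a cell.\<close>

lemma bounded_cell_of:
  fixes \<Phi> :: "'a::euclidean_space set"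
  assumes "span \<Phi> = UNIV"
  shows "bounded (cell_of \<Phi> m)"
proof -
  have "\<exists>B. \<forall>w\<in>cell_of \<Phi> m. \<bar>v \<bullet> w\<bar> \<le> B" for v
  proof -
    have "v \<in> span \<Phi>"
      using assms by simp
    then show ?thesis
    proof (induction rule: span_induct_alt)
      case base
      show ?case by (intro exI[of _ 0]) simp
    next
      case (step c \<alpha> v)
      then obtain B where B: "\<And>w. w \<in> cell_of \<Phi> m \<Longrightarrow> \<bar>v \<bullet> w\<bar> \<le> B"
        by blast
      have "\<bar>(c *\<^sub>R \<alpha> + v) \<bullet> w\<bar> \<le> \<bar>c\<bar> * (\<bar>\<alpha> \<bullet> m\<bar> + 1) + B" if w: "w \<in> cell_of \<Phi> m" for w
      proof -
        have "\<lfloor>\<alpha> \<bullet> w\<rfloor> = \<lfloor>\<alpha> \<bullet> m\<rfloor>"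
          using w step.hyps by (simp add: cell_of_def)
        then have "\<bar>\<alpha> \<bullet> w\<bar> \<le> \<bar>\<alpha> \<bullet> m\<bar> + 1"
          by linarith
        then have "\<bar>c\<bar> * \<bar>\<alpha> \<bullet> w\<bar> \<le> \<bar>c\<bar> * (\<bar>\<alpha> \<bullet> m\<bar> + 1)"
          by (simp add: mult_left_mono)
        then have "\<bar>c * (\<alpha> \<bullet> w)\<bar> \<le> \<bar>c\<bar> * (\<bar>\<alpha> \<bullet> m\<bar> + 1)"
          by (simp add: abs_mult)
        then show ?thesis
          using B[OF w] by (simp add: inner_add_left)
      qed
      then show ?case by blast
    qed
  qed
  then obtain B where B: "\<And>v w. w \<in> cell_of \<Phi> m \<Longrightarrow> \<bar>v \<bullet> w\<bar> \<le> B v"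
    by metis
  have "norm w \<le> (\<Sum>b\<in>Basis. B b)" if "w \<in> cell_of \<Phi> m" for w
    using norm_le_l1[of w] B[OF that] by (smt (verit) inner_commute sum_mono)
  then show ?thesis
    by (auto simp: bounded_iff)
qed

lemma eventually_floor_ceiling_sandwich:
  fixes a e :: real
  shows "\<forall>\<^sub>F s in at_right 0. of_int \<lfloor>a + s * e\<rfloor> \<le> a \<and> a \<le> of_int \<lceil>a + s * e\<rceil>"
proof -
  have "\<forall>\<^sub>F s in at_right 0. s * e < of_int \<lfloor>a\<rfloor> + 1 - a"
    by (rule eventually_at_right_0_linear_less) linarith
  moreover have "\<forall>\<^sub>F s in at_right 0. s * (- e) < a - (of_int \<lceil>a\<rceil> - 1)"
    by (rule eventually_at_right_0_linear_less) linarith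
  ultimately show ?thesis
  proof eventually_elim
    case (elim s)
    have "\<lfloor>a + s * e\<rfloor> \<le> \<lfloor>a\<rfloor>" "\<lceil>a\<rceil> \<le> \<lceil>a + s * e\<rceil>"
      using elim by (simp add: floor_le_iff algebra_simps, simp add: le_ceiling_iff algebra_simps)
    then show ?case
      by linarith
  qed
qed

text \<open>
  Moving a little along a direction that is parallel to all walls through \<open>y\<close> does not leave
  the cell of \<open>y\<close>; so \<open>y\<close> is a vertex of the complex iff only the zero direction is parallel
  to all these walls.
\<close>

lemma eventually_in_cell_of:
  fixes \<Phi> :: "'a::euclidean_space set"
  assumes "finite \<Phi>" and v: "\<And>\<alpha>. \<alpha> \<in> \<Phi> \<Longrightarrow> \<alpha> \<bullet> y \<in> \<int> \<Longrightarrow> \<alpha> \<bullet> v = 0"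
  shows "\<forall>\<^sub>F s in at_right 0. y + s *\<^sub>R v \<in> cell_of \<Phi> y"
proof -
  have "\<forall>\<^sub>F s in at_right 0. \<lfloor>\<alpha> \<bullet> (y + s *\<^sub>R v)\<rfloor> = \<lfloor>\<alpha> \<bullet> y\<rfloor> \<and> \<lceil>\<alpha> \<bullet> (y + s *\<^sub>R v)\<rceil> = \<lceil>\<alpha> \<bullet> y\<rceil>"
    if "\<alpha> \<in> \<Phi>" for \<alpha>
  proof (cases "\<alpha> \<bullet> y \<in> \<int>")
    case True
    then show ?thesis
      using v[OF that] by (simp add: inner_add_right)
  next
    case False
    define a e where "a = \<alpha> \<bullet> y" and "e = \<alpha> \<bullet> v"
    have k: "of_int \<lfloor>a\<rfloor> < a" "\<lceil>a\<rceil> = \<lfloor>a\<rfloor> + 1"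
      using not_Ints_floor_ceiling[OF False] by (simp_all only: a_def)
    have "\<forall>\<^sub>F s in at_right 0. s * e < of_int \<lfloor>a\<rfloor> + 1 - a"
      by (rule eventually_at_right_0_linear_less) linarith
    moreover have "\<forall>\<^sub>F s in at_right 0. s * (- e) < a - of_int \<lfloor>a\<rfloor>"
      by (rule eventually_at_right_0_linear_less) (use k in simp)
    ultimately show ?thesis
    proof eventually_elim
      case (elim s)
      then have "\<lfloor>a + s * e\<rfloor> = \<lfloor>a\<rfloor> \<and> \<lceil>a + s * e\<rceil> = \<lceil>a\<rceil>"
        using k(2) by (auto intro!: floor_unique ceiling_unique)
      then show ?case
        by (simp add: a_def e_def inner_add_right)
    qed
  qed
  then show ?thesis
    using assms(1) by (simp add: cell_of_def eventually_ball_finite)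
qed

lemma coxeter_vertices_iff:
  fixes \<Phi> :: "'a::euclidean_space set"
  assumes "finite \<Phi>"
  shows "y \<in> coxeter_vertices \<Phi> \<longleftrightarrow> (\<forall>v. (\<forall>\<alpha>\<in>\<Phi>. \<alpha> \<bullet> y \<in> \<int> \<longrightarrow> \<alpha> \<bullet> v = 0) \<longrightarrow> v = 0)"
proof -
  have "y \<in> coxeter_vertices \<Phi> \<longleftrightarrow> (\<exists>m. {y} = cell_of \<Phi> m)"
    by (simp add: coxeter_vertices_def coxeter_cell_iff)
  also have "\<dots> \<longleftrightarrow> cell_of \<Phi> y = {y}"
    using self_in_cell_of by (metis singletonD)
  also have "\<dots> \<longleftrightarrow> (\<forall>v. (\<forall>\<alpha>\<in>\<Phi>. \<alpha> \<bullet> y \<in> \<int> \<longrightarrow> \<alpha> \<bullet> v = 0) \<longrightarrow> v = 0)"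
  proof (intro iffI allI impI)
    fix v assume cell: "cell_of \<Phi> y = {y}" and v: "\<forall>\<alpha>\<in>\<Phi>. \<alpha> \<bullet> y \<in> \<int> \<longrightarrow> \<alpha> \<bullet> v = 0"
    have "\<forall>\<^sub>F s in at_right 0. y + s *\<^sub>R v \<in> cell_of \<Phi> y"
      using eventually_in_cell_of[OF assms] v by blast
    moreover have "\<forall>\<^sub>F s::real in at_right 0. s > 0"
      by (rule eventually_at_right_less)
    ultimately have "\<forall>\<^sub>F s::real in at_right 0. v = 0"
      by eventually_elim (simp add: cell)
    then show "v = 0"
      by simp
  next
    assume *: "\<forall>v. (\<forall>\<alpha>\<in>\<Phi>. \<alpha> \<bullet> y \<in> \<int> \<longrightarrow> \<alpha> \<bullet> v = 0) \<longrightarrow> v = 0"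
    have "w = y" if w: "w \<in> cell_of \<Phi> y" for w
    proof -
      have "\<alpha> \<bullet> (w - y) = 0" if "\<alpha> \<in> \<Phi>" "\<alpha> \<bullet> y \<in> \<int>" for \<alpha>
      proof -
        have "\<lfloor>\<alpha> \<bullet> y\<rfloor> = \<lceil>\<alpha> \<bullet> y\<rceil>"
          using that(2) by (auto elim: Ints_cases)
        moreover have "\<lfloor>\<alpha> \<bullet> w\<rfloor> = \<lfloor>\<alpha> \<bullet> y\<rfloor>" "\<lceil>\<alpha> \<bullet> w\<rceil> = \<lceil>\<alpha> \<bullet> y\<rceil>"
          using w that(1) by (auto simp: cell_of_def)
        ultimately have "\<alpha> \<bullet> w = \<alpha> \<bullet> y"
          by linarith
        then show ?thesis
          by (simp add: inner_diff_right)
      qed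
      then show ?thesis
        using * by (metis eq_iff_diff_eq_0)
    qed
    then show "cell_of \<Phi> y = {y}"
      using self_in_cell_of by blast
  qed
  finally show ?thesis .
qed

lemma closure_cell_of_mono:
  assumes "y \<in> closure (cell_of \<Phi> m)"
  shows "closure (cell_of \<Phi> y) \<subseteq> closure (cell_of \<Phi> m)"
proof
  fix w assume w: "w \<in> closure (cell_of \<Phi> y)"
  have "of_int \<lfloor>\<alpha> \<bullet> m\<rfloor> \<le> \<alpha> \<bullet> w \<and> \<alpha> \<bullet> w \<le> of_int \<lceil>\<alpha> \<bullet> m\<rceil>" if "\<alpha> \<in> \<Phi>" for \<alpha>
  proof -
    have "\<lfloor>\<alpha> \<bullet> m\<rfloor> \<le> \<lfloor>\<alpha> \<bullet> y\<rfloor>" "\<lceil>\<alpha> \<bullet> y\<rceil> \<le> \<lceil>\<alpha> \<bullet> m\<rceil>"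
      using assms that by (auto simp: closure_cell_of le_floor_iff ceiling_le_iff)
    moreover have "of_int \<lfloor>\<alpha> \<bullet> y\<rfloor> \<le> \<alpha> \<bullet> w" "\<alpha> \<bullet> w \<le> of_int \<lceil>\<alpha> \<bullet> y\<rceil>"
      using w that by (auto simp: closure_cell_of)
    ultimately show ?thesis
      by linarith
  qed
  then show "w \<in> closure (cell_of \<Phi> m)"
    by (simp add: closure_cell_of)
qed

text \<open>
  The extreme points of the closure of a cell, as they enter the notion of a neighbor, are the
  vertices of the complex that lie in the closure.
\<close>

lemma cell_vertices_cell_of:
  fixes \<Phi> :: "'a::euclidean_space set"
  assumes "finite \<Phi>"
  shows "cell_vertices (cell_of \<Phi> m) = coxeter_vertices \<Phi> \<inter> closure (cell_of \<Phi> m)"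
proof (intro equalityI subsetI IntI)
  fix y assume "y \<in> cell_vertices (cell_of \<Phi> m)"
  then have y: "y \<in> closure (cell_of \<Phi> m)"
    and ext: "\<And>a b. a \<in> closure (cell_of \<Phi> m) \<Longrightarrow> b \<in> closure (cell_of \<Phi> m) \<Longrightarrow> y \<notin> open_segment a b"
    by (auto simp: cell_vertices_def extreme_point_of_def)
  show "y \<in> closure (cell_of \<Phi> m)" by (fact y)
  \<comment> \<open>Otherwise \<open>y\<close> is the midpoint of a segment within its own cell.\<close>
  have "v = 0" if v: "\<forall>\<alpha>\<in>\<Phi>. \<alpha> \<bullet> y \<in> \<int> \<longrightarrow> \<alpha> \<bullet> v = 0" for v
  proof -
    have "\<forall>\<^sub>F s in at_right 0. y + s *\<^sub>R v \<in> cell_of \<Phi> y"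
      by (rule eventually_in_cell_of[OF assms]) (use v in simp)
    moreover have "\<forall>\<^sub>F s in at_right 0. y + s *\<^sub>R (- v) \<in> cell_of \<Phi> y"
      by (rule eventually_in_cell_of[OF assms]) (use v in simp)
    moreover have "\<forall>\<^sub>F s::real in at_right 0. s > 0"
      by (rule eventually_at_right_less)
    ultimately have "\<forall>\<^sub>F s::real in at_right 0. v = 0"
    proof eventually_elim
      case (elim s)
      have "y + s *\<^sub>R v \<in> closure (cell_of \<Phi> m)" "y + s *\<^sub>R (- v) \<in> closure (cell_of \<Phi> m)"
        using elim closure_cell_of_mono[OF y] closure_subset by blast+
      then have "y \<notin> open_segment (y + s *\<^sub>R v) (y + s *\<^sub>R (- v))"
        by (rule ext)
      moreover have "midpoint (y + s *\<^sub>R v) (y + s *\<^sub>R (- v)) = y"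
        by (simp add: midpoint_def algebra_simps flip: scaleR_2)
      ultimately have "y + s *\<^sub>R v = y + s *\<^sub>R (- v)"
        by (metis midpoint_in_open_segment)
      then have "s *\<^sub>R v + s *\<^sub>R v = 0"
        by (simp add: eq_neg_iff_add_eq_0)
      then have "(2 * s) *\<^sub>R v = 0"
        by (metis scaleR_2 scaleR_scaleR)
      then show ?case
        using elim by simp
    qed
    then show ?thesis
      by simp
  qed
  then show "y \<in> coxeter_vertices \<Phi>"
    by (simp add: coxeter_vertices_iff[OF assms])
next
  fix y assume "y \<in> coxeter_vertices \<Phi> \<inter> closure (cell_of \<Phi> m)"
  then have y: "y \<in> closure (cell_of \<Phi> m)"
    and vert: "\<And>v. (\<forall>\<alpha>\<in>\<Phi>. \<alpha> \<bullet> y \<in> \<int> \<longrightarrow> \<alpha> \<bullet> v = 0) \<Longrightarrow> v = 0"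
    using coxeter_vertices_iff[OF assms] by auto
  have False if a: "a \<in> closure (cell_of \<Phi> m)" and b: "b \<in> closure (cell_of \<Phi> m)"
    and seg: "y \<in> open_segment a b" for a b
  proof -
    obtain t where t: "a \<noteq> b" "0 < t" "t < 1" "y = (1 - t) *\<^sub>R a + t *\<^sub>R b"
      using seg by (auto simp: in_segment)
    \<comment> \<open>A wall through \<open>y\<close> has the whole cell on one side, so it contains the segment.\<close>
    have "\<alpha> \<bullet> (b - a) = 0" if "\<alpha> \<in> \<Phi>" and int: "\<alpha> \<bullet> y \<in> \<int>" for \<alpha>
    proof -
      obtain k where k: "\<alpha> \<bullet> y = of_int k"
        using int by (auto elim: Ints_cases)
      have bd: "of_int \<lfloor>\<alpha> \<bullet> m\<rfloor> \<le> \<alpha> \<bullet> z \<and> \<alpha> \<bullet> z \<le> of_int \<lceil>\<alpha> \<bullet> m\<rceil>"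
        if "z \<in> {a, b, y}" for z
        using a b y that \<open>\<alpha> \<in> \<Phi>\<close> unfolding closure_cell_of by blast
      have "\<lceil>\<alpha> \<bullet> m\<rceil> \<le> \<lfloor>\<alpha> \<bullet> m\<rfloor> + 1"
        by linarith
      moreover have "\<lfloor>\<alpha> \<bullet> m\<rfloor> \<le> k" "k \<le> \<lceil>\<alpha> \<bullet> m\<rceil>"
        using bd[of y] k by simp_all
      ultimately consider "k = \<lfloor>\<alpha> \<bullet> m\<rfloor>" | "k = \<lceil>\<alpha> \<bullet> m\<rceil>"
        by linarith
      moreover have eq: "(1 - t) * (\<alpha> \<bullet> a - of_int k) + t * (\<alpha> \<bullet> b - of_int k) = 0"
        using k t(4) by (simp add: inner_add_right algebra_simps)
      ultimately have "\<alpha> \<bullet> a = of_int k \<and> \<alpha> \<bullet> b = of_int k"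
      proof cases
        case 1
        then have "0 \<le> (1 - t) * (\<alpha> \<bullet> a - of_int k)" "0 \<le> t * (\<alpha> \<bullet> b - of_int k)"
          using bd[of a] bd[of b] t by simp_all
        then show ?thesis
          using eq t by (simp add: add_nonneg_eq_0_iff)
      next
        case 2
        then have "(1 - t) * (\<alpha> \<bullet> a - of_int k) \<le> 0" "t * (\<alpha> \<bullet> b - of_int k) \<le> 0"
          using bd[of a] bd[of b] t by (simp_all add: mult_le_0_iff)
        then show ?thesis
          using eq t by (simp add: add_nonpos_eq_0_iff)
      qed
      then show ?thesis
        by (simp add: inner_diff_right)
    qed
    then have "b - a = 0"
      by (intro vert) blast
    then show False
      using t(1) by simp
  qed
  then show "y \<in> cell_vertices (cell_of \<Phi> m)"
    using y by (auto simp: cell_vertices_def extreme_point_of_def)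
qed

lemma eventually_in_closure_cell_of:
  fixes \<Phi> :: "'a::euclidean_space set"
  assumes "finite \<Phi>"
  shows "\<forall>\<^sub>F s in at_right 0. x \<in> closure (cell_of \<Phi> (x + s *\<^sub>R u))"
proof -
  have "\<forall>\<^sub>F s in at_right 0. \<forall>\<alpha>\<in>\<Phi>.
      of_int \<lfloor>\<alpha> \<bullet> (x + s *\<^sub>R u)\<rfloor> \<le> \<alpha> \<bullet> x \<and> \<alpha> \<bullet> x \<le> of_int \<lceil>\<alpha> \<bullet> (x + s *\<^sub>R u)\<rceil>"
    using assms eventually_floor_ceiling_sandwich
    by (simp add: eventually_ball_finite inner_add_right)
  then show ?thesis
    by (simp add: closure_cell_of)
qed

lemma integral_L_convex_polyhedron_closure_cell:
  fixes \<Phi> :: "'a::euclidean_space set"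
  assumes "integral_L_convex_polyhedron \<Phi> P" and "m \<in> P"
  shows "closure (cell_of \<Phi> m) \<subseteq> P"
proof
  fix w assume w: "w \<in> closure (cell_of \<Phi> m)"
  obtain \<gamma> :: "'a \<Rightarrow> ereal"
    where \<gamma>: "\<forall>\<alpha>\<in>\<Phi>. \<gamma> \<alpha> \<in> insert \<infinity> (range (\<lambda>k::int. ereal (of_int k)))"
      and P: "P = {x. \<forall>\<alpha>\<in>\<Phi>. ereal (\<alpha> \<bullet> x) \<le> \<gamma> \<alpha>}"
    using assms(1) unfolding integral_L_convex_polyhedron_def by blast
  have "ereal (\<alpha> \<bullet> w) \<le> \<gamma> \<alpha>" if "\<alpha> \<in> \<Phi>" for \<alpha>
  proof (cases "\<gamma> \<alpha> = \<infinity>")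
    case False
    then obtain k :: int where k: "\<gamma> \<alpha> = ereal (of_int k)"
      using \<gamma> \<open>\<alpha> \<in> \<Phi>\<close> by auto
    then have "\<lceil>\<alpha> \<bullet> m\<rceil> \<le> k"
      using assms(2) that P by (force simp: ceiling_le_iff)
    moreover have "\<alpha> \<bullet> w \<le> of_int \<lceil>\<alpha> \<bullet> m\<rceil>"
      using w that by (simp add: closure_cell_of)
    ultimately show ?thesis
      using k by (simp add: order_trans)
  qed simp
  then show "w \<in> P"
    by (simp add: P)
qed

lemma cell_vertex_decreasing:
  fixes \<Phi> :: "'a::euclidean_space set"
  assumes "span \<Phi> = UNIV" and "p \<bullet> m < c"
  obtains y where "y \<in> cell_vertices (cell_of \<Phi> m)" and "p \<bullet> y < c"
proof -
  let ?K = "closure (cell_of \<Phi> m)"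
  have "?K = (\<Inter>\<alpha>\<in>\<Phi>. {w. of_int \<lfloor>\<alpha> \<bullet> m\<rfloor> \<le> \<alpha> \<bullet> w} \<inter> {w. \<alpha> \<bullet> w \<le> of_int \<lceil>\<alpha> \<bullet> m\<rceil>})"
    by (auto simp: closure_cell_of)
  then have "convex ?K"
    by (simp add: convex_INT convex_Int convex_halfspace_le convex_halfspace_ge)
  moreover have "compact ?K"
    using bounded_cell_of[OF assms(1)] by simp
  ultimately have K: "?K = convex hull (cell_vertices (cell_of \<Phi> m))"
    unfolding cell_vertices_def by (rule Krein_Milman_Minkowski[rotated])
  have "m \<in> ?K"
    using self_in_cell_of closure_subset by blast
  have "\<not> cell_vertices (cell_of \<Phi> m) \<subseteq> {y. c \<le> p \<bullet> y}"
  proof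
    assume "cell_vertices (cell_of \<Phi> m) \<subseteq> {y. c \<le> p \<bullet> y}"
    then have "?K \<subseteq> {y. c \<le> p \<bullet> y}"
      unfolding K by (rule hull_minimal) (rule convex_halfspace_ge)
    then show False
      using \<open>m \<in> ?K\<close> assms(2) by auto
  qed
  then show ?thesis
    using that not_le by blast
qed

section \<open>Descent to a neighboring vertex\<close>

lemma L_convex_descent:
  fixes \<Phi> :: "'a::euclidean_space set"
  assumes "finite \<Phi>" and "span \<Phi> = UNIV" and h: "primal_integral_L_convex \<Phi> h"
    and x: "x \<in> coxeter_vertices \<Phi>" and hx: "h x \<noteq> \<infinity>" and z: "h z < h x"
  obtains y where "proper_neighbor \<Phi> x y" and "h y < h x"
proof -
  have fin: "h w \<noteq> - \<infinity>" for w
    using h by (simp add: primal_integral_L_convex_def proper_fun_def)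
  obtain c where c: "h x = ereal c"
    using fin[of x] hx by (cases "h x") auto
  obtain c' where c': "h z = ereal c'"
    using fin[of z] z c by (cases "h z") auto
  define u where "u = z - x"
  obtain p where sub: "\<And>y r. (y, r) \<in> ereal_epigraph h \<Longrightarrow> c + p \<bullet> (y - x) \<le> r"
    and pu: "p \<bullet> u \<le> c' - c"
    and lin: "\<forall>\<^sub>F s in at_right 0. (x + s *\<^sub>R u, c + s * (p \<bullet> u)) \<in> ereal_epigraph h"
  proof (rule locally_polyhedral_subgradient[of "ereal_epigraph h" x c u "c' - c"])
    show "locally_polyhedral (ereal_epigraph h)"
      using h by (simp add: primal_integral_L_convex_def locally_polyhedral_convex_def)
  qed (auto simp: ereal_epigraph_def c c' u_def)
  have "p \<bullet> u < 0"
    using pu z c c' by simp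
  define P where "P = argmin_on UNIV (\<lambda>w. h w - ereal (p \<bullet> w))"
  have sub': "ereal (c - p \<bullet> x) \<le> h w - ereal (p \<bullet> w)" for w
    using sub[of w "real_of_ereal (h w)"] fin[of w]
    by (cases "h w") (auto simp: ereal_epigraph_def inner_diff_right)
  \<comment> \<open>On its linearity domain \<open>P\<close> the function agrees with its affine minorant at \<open>x\<close>.\<close>
  have P_iff: "w \<in> P \<longleftrightarrow> h w = ereal (c + p \<bullet> (w - x))" for w
  proof
    assume "w \<in> P"
    then have "\<not> (h x - ereal (p \<bullet> x) < h w - ereal (p \<bullet> w))"
      by (auto simp: P_def argmin_on_def is_arg_min_def)
    then have "h w - ereal (p \<bullet> w) = ereal (c - p \<bullet> x)"
      using sub'[of w] c by (simp add: not_less)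
    then show "h w = ereal (c + p \<bullet> (w - x))"
      by (cases "h w") (auto simp: inner_diff_right)
  next
    assume "h w = ereal (c + p \<bullet> (w - x))"
    then have "h w - ereal (p \<bullet> w) = ereal (c - p \<bullet> x)"
      by (simp add: inner_diff_right)
    then show "w \<in> P"
      using sub' by (auto simp: P_def argmin_on_def is_arg_min_def not_less)
  qed
  have "x \<in> P"
    by (simp add: P_iff c)
  then have poly: "integral_L_convex_polyhedron \<Phi> P"
    using h unfolding primal_integral_L_convex_def linearity_domains_def P_def by blast
  have "\<forall>\<^sub>F s::real in at_right 0. s > 0"
    by (rule eventually_at_right_less)
  with lin eventually_in_closure_cell_of[OF assms(1), of x u]
  have "\<forall>\<^sub>F s in at_right 0. (x + s *\<^sub>R u, c + s * (p \<bullet> u)) \<in> ereal_epigraph h \<and>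
      x \<in> closure (cell_of \<Phi> (x + s *\<^sub>R u)) \<and> s > 0"
    by eventually_elim auto
  then obtain s where s: "(x + s *\<^sub>R u, c + s * (p \<bullet> u)) \<in> ereal_epigraph h"
      "x \<in> closure (cell_of \<Phi> (x + s *\<^sub>R u))" "s > 0"
    using eventually_happens trivial_limit_at_right_real by blast
  define m where "m = x + s *\<^sub>R u"
  have "m \<in> P"
  proof -
    have "h m \<le> ereal (c + p \<bullet> (m - x))"
      using s(1) by (simp add: ereal_epigraph_def m_def)
    moreover have "ereal (c + p \<bullet> (m - x)) \<le> h m"
      using sub'[of m] by (cases "h m") (auto simp: inner_diff_right)
    ultimately show ?thesis
      by (simp add: P_iff)
  qed
  have "p \<bullet> m < p \<bullet> x"
    using \<open>p \<bullet> u < 0\<close> s(3) by (simp add: m_def inner_add_right mult_pos_neg)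
  then obtain y where y: "y \<in> cell_vertices (cell_of \<Phi> m)" "p \<bullet> y < p \<bullet> x"
    by (rule cell_vertex_decreasing[OF assms(2)])
  have y': "y \<in> coxeter_vertices \<Phi>" "y \<in> closure (cell_of \<Phi> m)"
    using y(1) by (auto simp: cell_vertices_cell_of[OF assms(1)])
  have "x \<in> cell_vertices (cell_of \<Phi> m)"
    using x s(2) by (simp add: cell_vertices_cell_of[OF assms(1)] m_def)
  then have "proper_neighbor \<Phi> x y"
    unfolding proper_neighbor_def coxeter_cell_iff using y y' by blast
  moreover have "y \<in> P"
    using integral_L_convex_polyhedron_closure_cell[OF poly \<open>m \<in> P\<close>] y'(2) by blast
  then have "h y < h x"
    using y(2) by (simp add: P_iff c inner_diff_right)
  ultimately show ?thesis
    by (rule that)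
qed

theorem theorem6p5:
  fixes \<Phi> :: "'a::euclidean_space set" and f :: "'a \<Rightarrow> ereal" and x :: 'a
  assumes "root_system \<Phi>" and "essential \<Phi>" and "irreducible_roots \<Phi>"
    and "root_isomorphic \<Phi> (roots_A :: (real ^ 'n) set) \<or>
         root_isomorphic \<Phi> (roots_B :: (real ^ 'n) set) \<or>
         root_isomorphic \<Phi> (roots_C :: (real ^ 'n) set) \<or>
         root_isomorphic \<Phi> (roots_D :: (real ^ 'n) set)"
    and "L_convex \<Phi> f"
    and "x \<in> coxeter_vertices \<Phi>" and "\<bar>f x\<bar> \<noteq> \<infinity>"
  shows "x \<in> argmin_on (coxeter_vertices \<Phi>) f \<longleftrightarrow>
         (\<forall>y. proper_neighbor \<Phi> x y \<longrightarrow> f x \<le> f y)"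
proof
  assume "x \<in> argmin_on (coxeter_vertices \<Phi>) f"
  then show "\<forall>y. proper_neighbor \<Phi> x y \<longrightarrow> f x \<le> f y"
    by (auto simp: argmin_on_def is_arg_min_def proper_neighbor_def not_less)
next
  assume nb: "\<forall>y. proper_neighbor \<Phi> x y \<longrightarrow> f x \<le> f y"
  obtain h where h: "primal_integral_L_convex \<Phi> h"
    and fh: "\<And>v. v \<in> coxeter_vertices \<Phi> \<Longrightarrow> f v = h v"
    using assms(5) unfolding L_convex_def by blast
  have "finite \<Phi>" and "span \<Phi> = UNIV"
    using assms(1,2) by (simp_all add: root_system_def essential_def)
  have "\<not> f z < f x" if z: "z \<in> coxeter_vertices \<Phi>" for z
  proof
    assume "f z < f x"
    then have "h z < h x" "h x \<noteq> \<infinity>"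
      using fh z assms(6,7) by auto
    then obtain y where y: "proper_neighbor \<Phi> x y" "h y < h x"
      using L_convex_descent[OF \<open>finite \<Phi>\<close> \<open>span \<Phi> = UNIV\<close> h assms(6)] by blast
    then have "f y < f x"
      using fh assms(6) by (simp add: proper_neighbor_def)
    then show False
      using nb y(1) by (simp add: leD)
  qed
  then show "x \<in> argmin_on (coxeter_vertices \<Phi>) f"
    using assms(6) by (simp add: argmin_on_def is_arg_min_def)
qed

end
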